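(* Let $A$ be a $\lambda$-ring, let $n$ be an integer with $|n|\geq 2$, and let $a\in A$ satisfy $na=0$. Then $a^E=0$, where $$E=\max\{p^e+p^{e-1}\;:\;p\text{ prime},\ e\geq 1\text{ an integer},\ p^e\text{ divides }n\}.$$
   Context: A $\lambda$-ring is meant in the standard sense (a commutative ring with unit with $\lambda$-operations satisfying all the usual identities, sometimes called a special $\lambda$-ring). Equivalently, it is a commutative ring $A$ equipped, for each prime $p$, with a map $\theta^p\colon A\to A$ such that $\psi^p(a)=a^p-p\theta^p(a)$ defines a ring homomorphism $\psi^p\colon A\to A$ (the Adams operation), such that for all $a,b\in A$: $\theta^p(1)=0$; $\theta^p(a+b)=\theta^p(a)+\theta^p(b)+\sum_{j=1}^{p-1}\frac{1}{p}\binom{p}{j}a^jb^{p-j}$; $\theta^p(ab)=\theta^p(a)\psi^p(b)+a^p\theta^p(b)$; $\theta^p\psi^p(a)=\psi^p\theta^p(a)$; and such that $\psi^p$ and $\theta^r$ commute also for distinct primes $p\neq r$. *)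

theory Defs
  imports Complex_Main "HOL-Computational_Algebra.Primes"
begin

text \<open>
  The sort \<open>{comm_ring, comm_monoid_mult}\<close> describes commutative rings with unit. Unlike
  \<open>comm_ring_1\<close> it does not require \<open>0 \<noteq> 1\<close>, so the zero ring is included. Since \<open>of_int\<close>
  is available only under \<open>0 \<noteq> 1\<close>, integer multiples are written as iterated sums.
\<close>

definition int_scale :: "int \<Rightarrow> 'a::ab_group_add \<Rightarrow> 'a"  (infixr "\<cdot>\<^sub>Z" 75)
  where "n \<cdot>\<^sub>Z a = (if n \<ge> 0 then (\<Sum>_<nat n. a) else - (\<Sum>_<nat (- n). a))"

definition adams ::
  "(nat \<Rightarrow> 'a \<Rightarrow> 'a) \<Rightarrow> nat \<Rightarrow> 'a \<Rightarrow> 'a::{comm_ring, comm_monoid_mult}"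
  where "adams \<theta> p a = a ^ p - int p \<cdot>\<^sub>Z \<theta> p a"

text \<open>
  The operation \<open>\<theta> p\<close> is part of the structure only for prime \<open>p\<close>; its values at other
  indices are irrelevant. In \<open>theta_add\<close> the division is exact, because a prime \<open>p\<close>
  divides \<open>p choose j\<close> for \<open>0 < j < p\<close>.
\<close>

locale lambda_ring =
  fixes \<theta> :: "nat \<Rightarrow> 'a \<Rightarrow> 'a::{comm_ring, comm_monoid_mult}"
  assumes adams_one: "prime p \<Longrightarrow> adams \<theta> p 1 = 1"
    and adams_add: "prime p \<Longrightarrow> adams \<theta> p (a + b) = adams \<theta> p a + adams \<theta> p b"
    and adams_mult: "prime p \<Longrightarrow> adams \<theta> p (a * b) = adams \<theta> p a * adams \<theta> p b"
    and theta_one: "prime p \<Longrightarrow> \<theta> p 1 = 0"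
    and theta_add: "prime p \<Longrightarrow> \<theta> p (a + b) =
          \<theta> p a + \<theta> p b + (\<Sum>j=1..p-1. int ((p choose j) div p) \<cdot>\<^sub>Z (a ^ j * b ^ (p - j)))"
    and theta_mult: "prime p \<Longrightarrow> \<theta> p (a * b) = \<theta> p a * adams \<theta> p b + a ^ p * \<theta> p b"
    and theta_adams: "prime p \<Longrightarrow> \<theta> p (adams \<theta> p a) = adams \<theta> p (\<theta> p a)"
    and theta_adams_distinct: "prime p \<Longrightarrow> prime r \<Longrightarrow> p \<noteq> r \<Longrightarrow>
          adams \<theta> p (\<theta> r a) = \<theta> r (adams \<theta> p a)"

end

(* Suppose p^e a = 0 with p prime and e >= 1. Expanding theta^p(a * p^e) = 0 gives
   p^e theta^p(a) = p^(e-1) a^p, that is, p^(e-1) psi^p(a) = 0. If e = 1, then a^p = p theta^p(a),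
   which is killed by a. If e >= 2, put b = psi^p(a) and N = p^(e-1) + p^(e-2). In the expansion
   of a^(p N) = (b + p theta^p(a))^N the term b^N vanishes by induction on e, the term
   (p theta^p(a))^N vanishes because p^(e+1) theta^p(a) = 0 and N > e, and all the others vanish
   because p^(e-1) divides (N choose k) p^k for k >= 1 and kills b. For general n, write
   n = p^e m with p not dividing m; then (m a)^E = 0, so that m^E annihilates a^E. Hence the
   annihilator of a^E in the integers is contained in no prime ideal. *)

theory Submission
  imports Defs
begin

section \<open>Integer multiples\<close>

lemma int_scale_nat: "int n \<cdot>\<^sub>Z a = (\<Sum>_<n. a)"
  by (simp add: int_scale_def)

lemma int_scale_minus_nat: "(- int n) \<cdot>\<^sub>Z a = - (\<Sum>_<n. a)"
  by (auto simp: int_scale_def)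

text \<open>Together with \<open>int_scale_pred\<close>, this recurrence takes the place of the case
  split in the definition: the module laws follow by induction in both directions from 0.\<close>

lemma int_scale_succ: "(n + 1) \<cdot>\<^sub>Z a = n \<cdot>\<^sub>Z a + a"
proof (cases "n \<ge> 0")
  case True
  then obtain m where m: "n = int m" using nonneg_int_cases by blast
  have "n + 1 = int (Suc m)" using m by simp
  then show ?thesis unfolding m int_scale_nat by (simp only: int_scale_nat sum.lessThan_Suc)
next
  case False
  then obtain m where m: "n = - int (Suc m)"
    by (metis int_cases of_nat_0_le_iff)
  have "n + 1 = - int m" using m by simp
  then show ?thesis unfolding m
    by (simp only: int_scale_minus_nat sum.lessThan_Suc) simp
qed

lemma int_scale_0_left: "0 \<cdot>\<^sub>Z a = 0"
  by (simp add: int_scale_def)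

lemma int_scale_add_left: "(m + n) \<cdot>\<^sub>Z a = m \<cdot>\<^sub>Z a + n \<cdot>\<^sub>Z a"
proof (induction m rule: int_induct[where k = 0])
  case base
  show ?case by (simp add: int_scale_0_left)
next
  case (step1 i)
  then show ?case using int_scale_succ[of "i + n" a] int_scale_succ[of i a]
    by (simp add: algebra_simps)
next
  case (step2 i)
  then show ?case using int_scale_succ[of "i - 1 + n" a] int_scale_succ[of "i - 1" a]
    by (simp add: algebra_simps)
qed

lemma int_scale_pred: "(n - 1) \<cdot>\<^sub>Z a = n \<cdot>\<^sub>Z a - a"
  using int_scale_succ[of "n - 1" a] by simp

interpretation int_scale: module "(\<cdot>\<^sub>Z) :: int \<Rightarrow> 'a \<Rightarrow> 'a::ab_group_add"
proof
  fix m n :: int and a b :: 'a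
  show "(m + n) \<cdot>\<^sub>Z a = m \<cdot>\<^sub>Z a + n \<cdot>\<^sub>Z a"
    by (rule int_scale_add_left)
  show "1 \<cdot>\<^sub>Z a = a"
    using int_scale_succ[of 0 a] by (simp add: int_scale_0_left)
  show "n \<cdot>\<^sub>Z (a + b) = n \<cdot>\<^sub>Z a + n \<cdot>\<^sub>Z b"
    by (induction n rule: int_induct[where k = 0])
      (simp_all add: int_scale_0_left int_scale_succ int_scale_pred)
  show "m \<cdot>\<^sub>Z n \<cdot>\<^sub>Z a = (m * n) \<cdot>\<^sub>Z a"
  proof (induction m rule: int_induct[where k = 0])
    case base
    show ?case by (simp add: int_scale_0_left)
  next
    case (step1 i)
    then show ?case using int_scale_add_left[of "i * n" n a]
      by (simp add: int_scale_succ distrib_right)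
  next
    case (step2 i)
    then show ?case using int_scale_add_left[of "(i - 1) * n" n a]
      by (simp add: int_scale_pred left_diff_distrib)
  qed
qed

lemma int_scale_mult_left:
  fixes a b :: "'a::comm_ring"
  shows "(n \<cdot>\<^sub>Z a) * b = n \<cdot>\<^sub>Z (a * b)"
  by (induction n rule: int_induct[where k = 0])
    (simp_all add: int_scale_succ int_scale_pred distrib_right left_diff_distrib)

lemma int_scale_mult_right:
  fixes a b :: "'a::comm_ring"
  shows "a * (n \<cdot>\<^sub>Z b) = n \<cdot>\<^sub>Z (a * b)"
  using int_scale_mult_left[of n b a] by (simp add: mult.commute)

lemma int_scale_power:
  fixes a :: "'a::{comm_ring, comm_monoid_mult}"
  shows "(n \<cdot>\<^sub>Z a) ^ k = (n ^ k) \<cdot>\<^sub>Z (a ^ k)"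
  by (induction k) (simp_all add: int_scale_mult_left int_scale_mult_right mult.commute)

lemma int_scale_eq_0_dvd:
  assumes "m \<cdot>\<^sub>Z a = 0" "m dvd n"
  shows "n \<cdot>\<^sub>Z a = 0"
  using assms by (metis dvdE int_scale.scale_scale int_scale.scale_zero_right mult.commute)

lemma power_eq_0_le:
  fixes a :: "'a::{comm_ring, comm_monoid_mult}"
  assumes "a ^ m = 0" "m \<le> n"
  shows "a ^ n = 0"
  using assms by (metis le_add_diff_inverse mult_zero_left power_add)

text \<open>The library's \<open>binomial_ring\<close> needs a ring with \<open>0 \<noteq> 1\<close>.\<close>

lemma int_scale_binomial:
  fixes a b :: "'a::{comm_ring, comm_monoid_mult}"
  shows "(a + b) ^ n = (\<Sum>k\<le>n. int (n choose k) \<cdot>\<^sub>Z (a ^ k * b ^ (n - k)))"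
proof (induction n)
  case 0
  show ?case by simp
next
  case (Suc n)
  let ?t = "\<lambda>c k. int c \<cdot>\<^sub>Z (a ^ k * b ^ (Suc n - k))"
  have "(a + b) ^ Suc n = (a + b) * (\<Sum>k\<le>n. int (n choose k) \<cdot>\<^sub>Z (a ^ k * b ^ (n - k)))"
    by (simp add: Suc)
  also have "\<dots> = (\<Sum>k\<le>n. ?t (n choose k) (Suc k)) + (\<Sum>k\<le>n. ?t (n choose k) k)"
    by (simp add: distrib_right sum_distrib_left int_scale_mult_right mult.assoc
        mult.left_commute[of b] Suc_diff_le sum.distrib int_scale.scale_right_distrib)
  \<comment> \<open>The added summand is zero because \<open>n choose Suc n = 0\<close>; after the
    index shift Pascal's rule applies term by term.\<close>
  also have "(\<Sum>k\<le>n. ?t (n choose k) k) = (\<Sum>k\<le>Suc n. ?t (n choose k) k)"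
    by (simp add: binomial_eq_0)
  also have "\<dots> = ?t 1 0 + (\<Sum>k\<le>n. ?t (n choose Suc k) (Suc k))"
    by (subst sum.atMost_Suc_shift) simp
  also have "(\<Sum>k\<le>n. ?t (n choose k) (Suc k)) + (?t 1 0 + (\<Sum>k\<le>n. ?t (n choose Suc k) (Suc k)))
      = ?t 1 0 + (\<Sum>k\<le>n. ?t (Suc n choose Suc k) (Suc k))"
    by (simp add: sum.distrib int_scale.scale_left_distrib)
  also have "\<dots> = (\<Sum>k\<le>Suc n. ?t (Suc n choose k) k)"
    by (subst sum.atMost_Suc_shift) simp
  finally show ?case .
qed

section \<open>Arithmetic of integers\<close>

text \<open>\<open>k * (N choose k)\<close> is N times a binomial coefficient, hence divisible by
  \<open>p ^ d\<close>. Cancelling k costs only its p-part \<open>p ^ v\<close>, and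
  \<open>v < p ^ v \<le> k\<close> shows that \<open>p ^ k\<close> supplies v + 1 factors p.\<close>

lemma prime_power_dvd_choose_mult_power:
  fixes p N k d :: nat
  assumes p: "prime p" and N: "p ^ d dvd N" and k: "k \<ge> 1"
  shows "p ^ Suc d dvd (N choose k) * p ^ k"
proof -
  obtain k' where k': "k = Suc k'" using k by (cases k) auto
  have absorb: "p ^ d dvd k * (N choose k)"
  proof (cases N)
    case (Suc M)
    show ?thesis unfolding k' Suc using N Suc by (metis Suc_times_binomial dvd_mult2)
  qed (simp add: k')
  define v where "v = multiplicity p k"
  obtain u where u: "k = p ^ v * u" "\<not> p dvd u"
    unfolding v_def using multiplicity_decompose'[of k p] p k not_prime_unit by (metis not_one_le_zero)
  have "coprime (p ^ d) u"
    using p u(2) by (simp add: prime_imp_coprime)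
  moreover have "p ^ d dvd u * (p ^ v * (N choose k))"
    using absorb by (subst (asm) u(1)) (simp add: ac_simps)
  ultimately have "p ^ d dvd p ^ v * (N choose k)"
    by (simp add: coprime_dvd_mult_right_iff)
  then have "p ^ Suc d dvd (N choose k) * p ^ Suc v"
    by (simp add: mult_dvd_mono ac_simps)
  moreover have "p ^ v \<le> k"
    using k by (intro dvd_imp_le) (auto simp: v_def multiplicity_dvd)
  then have "v < k"
    using power_gt_expt[of p v] prime_gt_1_nat[OF p] by simp
  then have "(N choose k) * p ^ Suc v dvd (N choose k) * p ^ k"
    by (intro mult_dvd_mono le_imp_power_dvd) auto
  ultimately show ?thesis by (rule dvd_trans)
qed

text \<open>The value of \<open>\<theta>\<^sup>p\<close> at \<open>m\<close>, namely \<open>(m ^ p - m) / p\<close>, computed from the sum formula.\<close>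

fun theta_nat :: "nat \<Rightarrow> nat \<Rightarrow> nat" where
  "theta_nat p 0 = 0"
| "theta_nat p (Suc m) = theta_nat p m + (\<Sum>j=1..p-1. ((p choose j) div p) * m ^ j)"

text \<open>Fermat's little theorem with its quotient: in the expansion of
  \<open>(m + 1) ^ p\<close> the inner coefficients are divisible by p, and their quotients give the
  increments of \<open>theta_nat\<close>.\<close>

lemma mult_theta_nat:
  assumes p: "prime p"
  shows "p * theta_nat p m + m = m ^ p"
proof (induction m)
  case 0
  show ?case using prime_gt_0_nat[OF p] by simp
next
  case (Suc m)
  have p1: "p > 1" using p by (rule prime_gt_1_nat)
  have split: "{..p} = insert 0 (insert p {1..p-1})" using p1 by auto
  have "Suc m ^ p = (\<Sum>j\<le>p. (p choose j) * m ^ j)"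
    using binomial_ring[of m 1 p] by simp
  also have "\<dots> = 1 + (m ^ p + (\<Sum>j=1..p-1. (p choose j) * m ^ j))"
    unfolding split using p1 by (subst sum.insert) auto
  also have "(\<Sum>j=1..p-1. (p choose j) * m ^ j)
      = p * (\<Sum>j=1..p-1. ((p choose j) div p) * m ^ j)"
    unfolding sum_distrib_left
  proof (rule sum.cong)
    fix j assume "j \<in> {1..p-1}"
    then have "p dvd (p choose j)"
      using p p1 by (intro dvd_choose_prime) auto
    then show "(p choose j) * m ^ j = p * (((p choose j) div p) * m ^ j)"
      by (simp add: mult.assoc[symmetric])
  qed simp
  finally show ?case using Suc by (simp add: distrib_left)
qed

section \<open>Torsion in lambda-rings\<close>

context lambda_ring
begin

lemma theta_zero:
  assumes p: "prime p"
  shows "\<theta> p 0 = 0"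
proof -
  have "(\<Sum>j=1..p-1. int ((p choose j) div p) \<cdot>\<^sub>Z (0 ^ j * 0 ^ (p - j) :: 'a)) = 0"
    by (intro sum.neutral) (auto simp: power_0_left gr0_conv_Suc Suc_le_eq)
  then show ?thesis using theta_add[OF p, of 0 0] by simp
qed

text \<open>Adding 1 repeatedly in \<open>theta_add\<close>, where \<open>\<theta> p 1 = 0\<close>,
  reproduces the recursion of \<open>theta_nat\<close>.\<close>

lemma theta_int_scale_one:
  assumes p: "prime p"
  shows "\<theta> p (int m \<cdot>\<^sub>Z 1) = int (theta_nat p m) \<cdot>\<^sub>Z 1"
proof (induction m)
  case 0
  show ?case by (simp add: theta_zero p)
next
  case (Suc m)
  have "int (Suc m) \<cdot>\<^sub>Z (1::'a) = int m \<cdot>\<^sub>Z 1 + 1"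
    using int_scale_succ[of "int m"] by (simp add: add.commute)
  then have "\<theta> p (int (Suc m) \<cdot>\<^sub>Z 1) = \<theta> p (int m \<cdot>\<^sub>Z 1)
      + (\<Sum>j=1..p-1. int ((p choose j) div p) \<cdot>\<^sub>Z (int m \<cdot>\<^sub>Z 1) ^ j)"
    by (simp only: theta_add[OF p] theta_one[OF p] power_one mult_1_right add_0_right)
  then show ?case
    by (simp add: Suc int_scale_power int_scale.scale_left_distrib int_scale.scale_sum_left)
qed

text \<open>Lets the factor \<open>adams \<theta> p b\<close> in \<open>theta_mult\<close> be
  replaced by b when b is a natural multiple of 1.\<close>

lemma adams_int_scale_one:
  assumes p: "prime p"
  shows "adams \<theta> p (int m \<cdot>\<^sub>Z 1) = int m \<cdot>\<^sub>Z 1"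
proof -
  have "adams \<theta> p (int m \<cdot>\<^sub>Z 1) = (int (m ^ p) - int (p * theta_nat p m)) \<cdot>\<^sub>Z 1"
    by (simp add: adams_def theta_int_scale_one[OF p] int_scale_power
        int_scale.scale_left_diff_distrib)
  also have "int (m ^ p) - int (p * theta_nat p m) = int m"
    using mult_theta_nat[OF p, of m] by linarith
  finally show ?thesis .
qed

text \<open>Apply \<open>theta_mult\<close> to a times q = \<open>p ^ Suc e\<close>, which is 0: q
  theta(a) + theta(q) a^p = 0. Here theta(q) = (q^p - q) / p is congruent to -p^e modulo q, and q
  kills a^p.\<close>

lemma theta_prime_power_torsion:
  assumes p: "prime p" and a: "int (p ^ Suc e) \<cdot>\<^sub>Z a = 0"
  shows "int (p ^ Suc e) \<cdot>\<^sub>Z \<theta> p a = int (p ^ e) \<cdot>\<^sub>Z (a ^ p)"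
proof -
  define q where "q = p ^ Suc e"
  define g where "g = theta_nat p q"
  have p1: "p > 1" using p by (rule prime_gt_1_nat)
  have q0: "q > 0" using p1 by (simp add: q_def)
  have qp: "int q \<cdot>\<^sub>Z (a ^ p) = 0"
    using a p1 int_scale_mult_left[of "int q" a "a ^ (p - 1)"]
    by (simp add: q_def[symmetric] power_Suc[symmetric] del: power_Suc)
  \<comment> \<open>The value of theta(q), with q / p = \<open>p ^ e\<close> moved to the left to
    avoid subtraction of naturals.\<close>
  have g: "g + p ^ e = q ^ (p - 1) * p ^ e"
  proof -
    have "p * (g + p ^ e) = q ^ p"
      using mult_theta_nat[OF p, of q] by (simp add: g_def q_def distrib_left)
    also have "\<dots> = q ^ (p - 1) * q"
      using p1 by (metis One_nat_def Suc_pred mult.commute order_less_trans power_Suc zero_less_one)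
    also have "\<dots> = p * (q ^ (p - 1) * p ^ e)"
      by (simp add: q_def)
    finally show ?thesis using p1 by simp
  qed
  have "q dvd q ^ (p - 1)"
    using p1 by simp
  then have "int q dvd int (g + p ^ e)"
    unfolding g by (simp only: int_dvd_int_iff dvd_mult2)
  then have "int (g + p ^ e) \<cdot>\<^sub>Z (a ^ p) = 0"
    by (rule int_scale_eq_0_dvd[OF qp])
  then have gp: "int g \<cdot>\<^sub>Z (a ^ p) + int (p ^ e) \<cdot>\<^sub>Z (a ^ p) = 0"
    by (simp only: of_nat_add int_scale.scale_left_distrib)
  have "a * (int q \<cdot>\<^sub>Z 1) = 0"
    using a by (simp add: int_scale_mult_right q_def)
  then have "0 = \<theta> p (a * (int q \<cdot>\<^sub>Z 1))"
    by (simp add: theta_zero p)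
  also have "\<dots> = int q \<cdot>\<^sub>Z \<theta> p a + int g \<cdot>\<^sub>Z (a ^ p)"
    unfolding theta_mult[OF p] adams_int_scale_one[OF p] theta_int_scale_one[OF p]
    by (simp add: int_scale_mult_right g_def)
  finally show ?thesis using gp unfolding q_def
    by (metis add.commute add_left_cancel)
qed

text \<open>After multiplication by \<open>p ^ e\<close> the two terms of a^p - p theta(a) agree.
  Thus psi lowers the exponent of the torsion by one, which drives the induction below.\<close>

lemma adams_prime_power_torsion:
  assumes p: "prime p" and a: "int (p ^ Suc e) \<cdot>\<^sub>Z a = 0"
  shows "int (p ^ e) \<cdot>\<^sub>Z adams \<theta> p a = 0"
  using theta_prime_power_torsion[OF p a]
  by (simp add: adams_def int_scale.scale_right_diff_distrib mult.commute)

lemma prime_power_torsion_nilpotent: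
  fixes a :: 'a
  assumes p: "prime p" and "int (p ^ Suc e) \<cdot>\<^sub>Z a = 0"
  shows "a ^ (p ^ Suc e + p ^ e) = 0"
  using assms(2)
\<comment> \<open>The element varies because the induction hypothesis is applied to psi(a).\<close>
proof (induction e arbitrary: a)
  case 0
  have "a ^ p = int p \<cdot>\<^sub>Z \<theta> p a"
    using theta_prime_power_torsion[OF p 0] by simp
  then show ?case using 0
    by (simp add: int_scale_mult_right int_scale_mult_left[symmetric])
next
  case (Suc e)
  define b where "b = adams \<theta> p a"
  define c where "c = int p \<cdot>\<^sub>Z \<theta> p a"
  define N where "N = p ^ Suc e + p ^ e"
  have p1: "p > 1" using p by (rule prime_gt_1_nat)
  have b: "int (p ^ Suc e) \<cdot>\<^sub>Z b = 0"
    unfolding b_def using p Suc.prems by (rule adams_prime_power_torsion)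
  \<comment> \<open>The bound matches the torsion of theta(a), killed by \<open>p ^ (e + 3)\<close>,
    with the N factors p in \<open>c ^ N\<close>. It holds because \<open>p ^ Suc e\<close> is at
    least e + 2 and \<open>p ^ e\<close> at least 1.\<close>
  have "e + 3 \<le> N"
    using power_gt_expt[of p "Suc e"] zero_less_power[of p e] p1 unfolding N_def by linarith
  have "int (p ^ (e + 3)) \<cdot>\<^sub>Z \<theta> p a = 0"
  proof -
    have "int (p ^ (e + 3)) = int p * int (p ^ Suc (Suc e))"
      by (simp add: numeral_3_eq_3)
    then have "int (p ^ (e + 3)) \<cdot>\<^sub>Z \<theta> p a = int p \<cdot>\<^sub>Z int (p ^ Suc (Suc e)) \<cdot>\<^sub>Z \<theta> p a"
      by (simp only: int_scale.scale_scale)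
    also have "\<dots> = int (p ^ Suc (Suc e)) \<cdot>\<^sub>Z (a ^ p)"
      unfolding theta_prime_power_torsion[OF p Suc.prems] by simp
    also have "\<dots> = (int (p ^ Suc (Suc e)) \<cdot>\<^sub>Z a) * a ^ (p - 1)"
      using p1 by (simp add: int_scale_mult_left power_Suc[symmetric] del: power_Suc)
    finally show ?thesis using Suc.prems by simp
  qed
  moreover have "int (p ^ (e + 3)) dvd int (p ^ N)"
    unfolding int_dvd_int_iff using \<open>e + 3 \<le> N\<close> by (rule le_imp_power_dvd)
  ultimately have "int (p ^ N) \<cdot>\<^sub>Z \<theta> p a = 0"
    by (metis int_scale_eq_0_dvd)
  moreover have "c ^ N = (int (p ^ N) \<cdot>\<^sub>Z \<theta> p a) * \<theta> p a ^ (N - 1)"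
    using \<open>e + 3 \<le> N\<close>
    by (simp add: c_def int_scale_power int_scale_mult_left power_Suc[symmetric] del: power_Suc)
  ultimately have cN: "c ^ N = 0" by simp
  have "int (N choose k) \<cdot>\<^sub>Z (c ^ k * b ^ (N - k)) = 0" if k: "k \<le> N" for k
  proof -
    consider "k = 0" | "k = N" | "1 \<le> k" "k < N" using k by linarith
    then show ?thesis
    proof cases
      case 1
      then show ?thesis using Suc.IH[OF b] by (simp add: N_def)
    next
      case 2
      then show ?thesis using cN by simp
    next
      case 3
      \<comment> \<open>N is \<open>p ^ e * (p + 1)\<close>. The factor \<open>p ^ k\<close> comes
        from \<open>c ^ k\<close>, and a factor b to be killed remains because k < N.\<close>
      have "p ^ e dvd N" by (simp add: N_def)
      then have "p ^ Suc e dvd (N choose k) * p ^ k"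
        using p 3 by (intro prime_power_dvd_choose_mult_power)
      then have "int (p ^ Suc e) dvd int ((N choose k) * p ^ k)"
        by (simp only: int_dvd_int_iff)
      with b have "int ((N choose k) * p ^ k) \<cdot>\<^sub>Z b = 0"
        by (rule int_scale_eq_0_dvd)
      moreover have "int (N choose k) \<cdot>\<^sub>Z (c ^ k * b ^ (N - k))
          = \<theta> p a ^ k * ((int ((N choose k) * p ^ k) \<cdot>\<^sub>Z b) * b ^ (N - k - 1))"
        using 3 by (simp add: c_def int_scale_power int_scale_mult_left int_scale_mult_right
            power_Suc[symmetric] Suc_diff_Suc del: power_Suc)
      ultimately show ?thesis by simp
    qed
  qed
  then have "(c + b) ^ N = 0"
    by (simp add: int_scale_binomial)
  moreover have "c + b = a ^ p"
    by (simp add: b_def c_def adams_def)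
  ultimately show ?case
    by (simp add: N_def power_mult[symmetric] distrib_left)
qed

end

section \<open>From prime powers to general integers\<close>

text \<open>The annihilator of x in the integers is nonzero, hence generated by its least positive
  element d. A prime divisor q of d would divide n and every annihilating m, against
  \<open>local\<close>; so d = 1.\<close>

lemma eq_0_if_annihilators_coprime:
  assumes n: "n \<noteq> 0" "n \<cdot>\<^sub>Z x = 0"
    and local: "\<And>q. prime q \<Longrightarrow> q dvd n \<Longrightarrow> \<exists>m. m \<cdot>\<^sub>Z x = 0 \<and> \<not> q dvd m"
  shows "x = 0"
proof -
  define P where "P d \<longleftrightarrow> d > 0 \<and> int d \<cdot>\<^sub>Z x = 0" for d
  define d where "d = (LEAST d. P d)"
  have "P (nat \<bar>n\<bar>)"
    using n int_scale_eq_0_dvd[OF n(2), of "\<bar>n\<bar>"] by (simp add: P_def)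
  then have d: "P d" unfolding d_def by (rule LeastI)
  have dvd: "int d dvd m" if "m \<cdot>\<^sub>Z x = 0" for m
  proof -
    define r where "r = m mod int d"
    have r: "0 \<le> r" "r < int d" using d by (auto simp: r_def P_def)
    have "r \<cdot>\<^sub>Z x = m \<cdot>\<^sub>Z x - (m div int d) \<cdot>\<^sub>Z int d \<cdot>\<^sub>Z x"
      by (simp add: r_def minus_div_mult_eq_mod[symmetric] int_scale.scale_left_diff_distrib)
    then have "r \<cdot>\<^sub>Z x = 0"
      using that d by (simp add: P_def del: int_scale.scale_scale)
    \<comment> \<open>A positive remainder would be an annihilator smaller than d.\<close>
    then have "\<not> nat r > 0"
      using r not_less_Least[of "nat r" P, folded d_def] \<open>r \<cdot>\<^sub>Z x = 0\<close> by (auto simp: P_def)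
    then show ?thesis using r by (simp add: r_def dvd_eq_mod_eq_0)
  qed
  have "is_unit (int d)"
  proof (rule ccontr)
    assume "\<not> is_unit (int d)"
    then obtain q where q: "prime q" "q dvd int d"
      using d prime_divisor_exists[of "int d"] by (auto simp: P_def)
    then show False
      using local[of q] dvd n(2) by (meson dvd_trans)
  qed
  then show "x = 0" using d by (simp add: P_def)
qed

text \<open>Makes \<open>Max_ge\<close> applicable: both p and e are at most \<open>p ^ e\<close>,
  hence at most |n|.\<close>

lemma finite_prime_power_sums:
  fixes n :: int
  assumes "n \<noteq> 0"
  shows "finite {p ^ e + p ^ (e - 1) | p e :: nat. prime p \<and> e \<ge> 1 \<and> int (p ^ e) dvd n}"
proof (rule finite_subset)
  let ?f = "\<lambda>(p, e). p ^ e + p ^ (e - 1) :: nat"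
  let ?B = "{..nat \<bar>n\<bar>} \<times> {..nat \<bar>n\<bar>}"
  show "finite (?f ` ?B)" by simp
  show "{p ^ e + p ^ (e - 1) | p e :: nat. prime p \<and> e \<ge> 1 \<and> int (p ^ e) dvd n} \<subseteq> ?f ` ?B"
  proof clarify
    fix p e :: nat
    assume p: "prime p" and e: "e \<ge> 1" and "int (p ^ e) dvd n"
    then have "int (p ^ e) \<le> \<bar>n\<bar>"
      using dvd_imp_le_int[OF assms, of "int (p ^ e)"] by simp
    moreover have "e < p ^ e"
      using prime_gt_1_nat[OF p] by (intro power_gt_expt) simp
    moreover have "p \<le> p ^ e"
      using prime_gt_0_nat[OF p] e by (intro self_le_power) auto
    ultimately have "(p, e) \<in> ?B"
      unfolding mem_Times_iff atMost_iff fst_conv snd_conv by linarith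
    then show "p ^ e + p ^ (e - 1) \<in> ?f ` ?B" by force
  qed
qed

theorem mainTheorem2:
  fixes \<theta> :: "nat \<Rightarrow> 'a \<Rightarrow> 'a::{comm_ring, comm_monoid_mult}"
    and n :: int
    and a :: 'a
  assumes "lambda_ring \<theta>"
    and "\<bar>n\<bar> \<ge> 2"
    and "n \<cdot>\<^sub>Z a = 0"
  shows "a ^ Max {p ^ e + p ^ (e - 1) | p e :: nat. prime p \<and> e \<ge> 1 \<and> int (p ^ e) dvd n} = 0"
proof -
  interpret lambda_ring \<theta> by (rule assms(1))
  let ?S = "{p ^ e + p ^ (e - 1) | p e :: nat. prime p \<and> e \<ge> 1 \<and> int (p ^ e) dvd n}"
  define E where "E = Max ?S"
  have n0: "n \<noteq> 0" using assms(2) by auto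
  have le_E: "p ^ Suc e + p ^ e \<le> E" if "prime p" "int (p ^ Suc e) dvd n" for p e
    unfolding E_def
    by (rule Max_ge[OF finite_prime_power_sums[OF n0]], rule CollectI,
        rule exI[of _ p], rule exI[of _ "Suc e"]) (use that in auto)
  \<comment> \<open>The witness is \<open>m ^ E\<close>, where m is the part of n prime to q. The
    bound \<open>E \<ge> 1\<close> does not depend on m and is recorded because the same estimate
    yields it.\<close>
  have part: "\<exists>m. m \<cdot>\<^sub>Z a ^ E = 0 \<and> \<not> q dvd m \<and> E \<ge> 1" if q: "prime q" "q dvd n" for q
  proof -
    obtain p where p: "q = int p" "prime p"
      using q(1) by (metis prime_int_nat_transfer int_nat_eq prime_ge_0_int)
    obtain m where m: "n = q ^ multiplicity q n * m" "\<not> q dvd m"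
      using multiplicity_decompose'[OF n0, of q] q(1) not_prime_unit by metis
    have "multiplicity q n > 0"
      using q n0 by (subst prime_multiplicity_gt_zero_iff) auto
    then obtain e where "multiplicity q n = Suc e"
      using gr0_implies_Suc by blast
    then have n: "n = int (p ^ Suc e) * m"
      using m(1) p(1) by simp
    then have "int (p ^ Suc e) \<cdot>\<^sub>Z m \<cdot>\<^sub>Z a = 0"
      using assms(3) by simp
    with p(2) have "(m \<cdot>\<^sub>Z a) ^ (p ^ Suc e + p ^ e) = 0"
      by (rule prime_power_torsion_nilpotent)
    moreover have E: "p ^ Suc e + p ^ e \<le> E"
      using p(2) n by (intro le_E) auto
    ultimately have "(m \<cdot>\<^sub>Z a) ^ E = 0"
      by (rule power_eq_0_le)
    then have "m ^ E \<cdot>\<^sub>Z a ^ E = 0"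
      by (simp add: int_scale_power)
    moreover have "\<not> q dvd m ^ E"
      using q(1) m(2) prime_dvd_power by blast
    moreover have "E \<ge> 1"
      using E prime_gt_0_nat[OF p(2)] by (simp add: Suc_le_eq order.strict_trans2[rotated])
    ultimately show ?thesis by blast
  qed
  \<comment> \<open>A prime divisor exists since |n| >= 2. It gives \<open>E \<ge> 1\<close>, so a
    divides \<open>a ^ E\<close> and n kills \<open>a ^ E\<close> as well.\<close>
  obtain q where "prime q" "q dvd n"
    using n0 assms(2) prime_divisor_exists[of n] by auto
  then have "E \<ge> 1" using part by blast
  then have "a ^ E = a * a ^ (E - 1)"
    by (simp add: power_Suc[symmetric] del: power_Suc)
  then have "n \<cdot>\<^sub>Z a ^ E = 0"
    using assms(3) by (simp add: int_scale_mult_left[symmetric])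
  with n0 have "a ^ E = 0"
  proof (rule eq_0_if_annihilators_coprime)
    fix q :: int
    assume "prime q" "q dvd n"
    then show "\<exists>m. m \<cdot>\<^sub>Z a ^ E = 0 \<and> \<not> q dvd m" using part by blast
  qed
  then show ?thesis by (simp only: E_def)
qed

end
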